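(* Let $G=\{g_1:=0,g_2,\ldots,g_n\}$ be a finite Abelian group of order $n\ge15$, let $A_{n-1}=\{{\boldsymbol x}\in\mathbb{Z}^n:\sum_{i=1}^n x_i=0\}$ and $$L_G=\Big\{{\boldsymbol x}=(x_1,\ldots,x_n)\in A_{n-1}:\ \sum_{j=2}^n x_j g_j=0\Big\}.$$ Then $S(L_G^{\#})=S(A_{n-1}^{\#})$.
   Context: Let $V=\{{\boldsymbol x}\in\mathbb{R}^n:\sum x_i=0\}=\operatorname{span}_{\mathbb R}L_G=\operatorname{span}_{\mathbb R}A_{n-1}$. For a full-rank lattice $L\subset V$, its dual is $L^{\#}=\{{\boldsymbol v}\in V:({\boldsymbol v},{\boldsymbol x})\in\mathbb{Z}\text{ for all }{\boldsymbol x}\in L\}$. For a lattice $\Lambda$, $S(\Lambda)$ is the set of nonzero vectors of $\Lambda$ of minimal Euclidean norm. *)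

theory Defs
  imports "HOL-Analysis.Analysis" "HOL-Algebra.Multiplicative_Group"
begin

definition zero_sum_space :: "(real ^ 'n) set" where
  "zero_sum_space = {x. (\<Sum>i\<in>UNIV. x $ i) = 0}"

text \<open>The root lattice \<open>A\<^bsub>n-1\<^esub>\<close> with \<open>n = CARD('n)\<close>, embedded in \<open>\<real>\<^sup>n\<close>.\<close>

definition root_lattice_A :: "(real ^ 'n) set" where
  "root_lattice_A = {x. (\<forall>i. x $ i \<in> \<int>) \<and> (\<Sum>i\<in>UNIV. x $ i) = 0}"

text \<open>The group is written multiplicatively, so \<open>\<Sum>\<^sub>j x\<^sub>j g\<^sub>j = 0\<close> becomes a product of integer
  powers equal to \<open>\<one>\<close>; \<open>i1\<close> is the index of the identity. Coordinates of elements of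
  \<open>root_lattice_A\<close> are integral, so the floor only converts them to type \<^typ>\<open>int\<close>.\<close>

definition group_lattice ::
    "('a, 'b) monoid_scheme \<Rightarrow> ('n \<Rightarrow> 'a) \<Rightarrow> 'n \<Rightarrow> (real ^ 'n) set" where
  "group_lattice G g i1 =
     {x \<in> root_lattice_A.
        (\<Otimes>\<^bsub>G\<^esub>j\<in>UNIV - {i1}. g j [^]\<^bsub>G\<^esub> \<lfloor>x $ j\<rfloor>) = \<one>\<^bsub>G\<^esub>}"

text \<open>The dual is taken inside the hyperplane \<open>zero_sum_space\<close>, not in all of \<open>\<real>\<^sup>n\<close>.\<close>

definition dual_lattice :: "(real ^ 'n) set \<Rightarrow> (real ^ 'n) set" where
  "dual_lattice L = {v \<in> zero_sum_space. \<forall>x\<in>L. v \<bullet> x \<in> \<int>}"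

definition minimal_vectors :: "(real ^ 'n) set \<Rightarrow> (real ^ 'n) set" where
  "minimal_vectors \<Lambda> =
     {v \<in> \<Lambda>. v \<noteq> 0 \<and> (\<forall>w\<in>\<Lambda>. w \<noteq> 0 \<longrightarrow> norm v \<le> norm w)}"

end

theory Submission
  imports Defs
begin

text \<open>A vector \<open>v\<close> of the dual of \<open>L\<^sub>G\<close> induces a character of \<open>G\<close>: up to the constant factor
  \<open>e(v\<^sub>1)\<close>, the map \<open>g\<^sub>i \<mapsto> e(v\<^sub>i)\<close> with \<open>e(t) = exp (2\<pi>it)\<close> is a homomorphism, and it is trivial
  exactly when \<open>v\<close> lies in the dual of \<open>A\<^bsub>n-1\<^esub>\<close>. For a nontrivial character the numbers \<open>e(v\<^sub>i)\<close> sum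
  to \<open>0\<close>. The inequality \<open>x\<^sup>2 \<ge> 1/16 - cos (2\<pi>x) / (4\<pi>)\<close>, in which both sides touch at \<open>x = \<plusminus>1/4\<close>,
  then gives \<open>\<parallel>v\<parallel>\<^sup>2 \<ge> n/16\<close>. For \<open>n \<ge> 15\<close> this exceeds \<open>(n - 1)/n\<close>, the squared norm of the vector
  \<open>e\<^sub>1 - (1/n, \<dots>, 1/n)\<close> in the dual of \<open>A\<^bsub>n-1\<^esub>\<close>, so no new vector can be minimal.\<close>

text \<open>Both sides are even in \<open>x\<close>, so \<open>x >= 0\<close> suffices. Centring at
  the touching point 1/4 turns the claim into \<open>sin y <= y + y^2 / pi\<close>, whose right side
  has the tangent of sine at 0 as its linear part.\<close>

lemma cos_two_pi_lower_bound:
  fixes x :: real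
  shows "1/16 - cos (2 * pi * x) / (4 * pi) \<le> x\<^sup>2"
proof -
  have nonneg: "1/16 - cos (2 * pi * x) / (4 * pi) \<le> x\<^sup>2" if x: "x \<ge> 0" for x :: real
  proof -
    define y where "y = 2 * pi * x - pi / 2"
    have cos: "cos (2 * pi * x) = - sin y"
      by (simp add: y_def sin_diff)
    have xy: "x = 1/4 + y / (2 * pi)"
      by (simp add: y_def field_simps)
    have "sin y \<le> y + y\<^sup>2 / pi"
    proof (cases "y \<ge> 0")
      case True
      then show ?thesis
        using sin_x_le_x[of y] by (smt (verit) divide_nonneg_pos pi_gt_zero zero_le_power2)
    next
      case False
      define z where "z = - y"
      have z: "0 \<le> z" "z \<le> pi / 2"
        using False x by (simp_all add: z_def y_def)
      have "\<bar>sin z - z\<bar> \<le> z ^ 3 / 6"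
        using Maclaurin_sin_bound[of z 3] z(1)
        by (simp add: sin_coeff_def eval_nat_numeral)
      then have "z - z ^ 3 / 6 \<le> sin z"
        by linarith
      moreover have "z ^ 3 / 6 \<le> z\<^sup>2 / pi"
      proof -
        \<comment> \<open>The quadratic term absorbs the cubic Taylor error as long as
          \<open>z * pi <= 6\<close>. Since \<open>x >= 0\<close> gives \<open>z <= pi / 2\<close>,
          the bound \<open>pi^2 <= 12\<close> is enough.\<close>
        have "z * pi \<le> (pi / 2) * pi"
          using z by (intro mult_right_mono) auto
        also have "\<dots> \<le> (3.15 / 2) * 3.15"
          using pi_approx by (intro mult_mono) auto
        finally have "z * pi \<le> 6"
          by simp
        then have "z\<^sup>2 * (z * pi) \<le> z\<^sup>2 * 6"
          by (intro mult_left_mono) auto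
        then show ?thesis
          by (simp add: field_simps power2_eq_square power3_eq_cube)
      qed
      ultimately show ?thesis
        by (simp add: z_def)
    qed
    then have "sin y / (4 * pi) \<le> (y + y\<^sup>2 / pi) / (4 * pi)"
      by (intro divide_right_mono) auto
    also have "\<dots> = x\<^sup>2 - 1/16"
      by (simp add: xy field_simps power2_eq_square)
    finally show ?thesis
      by (simp add: cos)
  qed
  show ?thesis
    using nonneg[of x] nonneg[of "- x"] by (cases "x \<ge> 0") auto
qed

lemma norm_power2_lower_bound:
  fixes v :: "real ^ 'n"
  assumes "(\<Sum>i\<in>UNIV. cis (2 * pi * v $ i)) = 0"
  shows "real CARD('n) / 16 \<le> (norm v)\<^sup>2"
proof -
  have "(\<Sum>i\<in>UNIV. cos (2 * pi * v $ i)) = Re (\<Sum>i\<in>UNIV. cis (2 * pi * v $ i))"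
    by simp
  then have "(\<Sum>i\<in>UNIV. cos (2 * pi * v $ i)) = 0"
    using assms by simp
  then have "real CARD('n) / 16 = (\<Sum>i\<in>UNIV. 1/16 - cos (2 * pi * v $ i) / (4 * pi))"
    by (simp add: sum_subtractf flip: sum_divide_distrib)
  also have "\<dots> \<le> (\<Sum>i\<in>UNIV. (v $ i)\<^sup>2)"
    by (intro sum_mono cos_two_pi_lower_bound)
  also have "\<dots> = (norm v)\<^sup>2"
    unfolding power2_norm_eq_inner by (simp add: inner_vec_def power2_eq_square)
  finally show ?thesis .
qed

text \<open>Pairing a dual vector with these relations yields the multiplicativity of its character.
  The \<open>i1\<close> term makes the coordinates sum to 0 and leaves the product unchanged, as
  \<open>g i1\<close> is the identity.\<close>

lemma relation_in_group_lattice: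
  fixes G (structure) and g :: "'n::finite \<Rightarrow> 'a"
  assumes "comm_group G" and g: "range g \<subseteq> carrier G" and "g i1 = \<one>"
    and k: "g k = g i \<otimes> g j"
  shows "axis k 1 - axis i 1 - axis j 1 + axis i1 1 \<in> group_lattice G g i1"
proof -
  interpret comm_group G by fact
  \<comment> \<open>The indices may coincide, so exponents are kept as sums of indicators instead of
    splitting into cases.\<close>
  define \<delta> :: "'n \<Rightarrow> 'n \<Rightarrow> int" where "\<delta> a l = of_bool (l = a)" for a l
  define x :: "real ^ 'n" where "x = axis k 1 - axis i 1 - axis j 1 + axis i1 1"
  have gc [simp]: "g l \<in> carrier G" for l
    using g by auto
  have x: "x $ l = real_of_int (\<delta> k l - \<delta> i l - \<delta> j l + \<delta> i1 l)" for l
    by (simp add: x_def \<delta>_def axis_def)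
  have "(\<Sum>l\<in>UNIV. x $ l) = 0"
    by (simp add: x_def axis_def sum.distrib sum_subtractf)
  moreover have "x $ l \<in> \<int>" for l
    unfolding x by (rule Ints_of_int)
  ultimately have "x \<in> root_lattice_A"
    by (simp add: root_lattice_A_def)
  have P: "(\<Otimes>l\<in>UNIV - {i1}. g l [^] \<delta> a l) = g a" for a
  proof (cases "a = i1")
    case True
    have "(\<Otimes>l\<in>UNIV - {i1}. g l [^] \<delta> a l) = \<one>"
      by (rule finprod_one_eqI) (simp add: \<delta>_def True)
    then show ?thesis
      using True \<open>g i1 = \<one>\<close> by simp
  next
    case False
    have "(\<Otimes>l\<in>UNIV - {i1}. g l [^] \<delta> a l) = (\<Otimes>l\<in>UNIV - {i1}. if a = l then g l else \<one>)"
      by (intro finprod_cong) (auto simp: \<delta>_def simp_implies_def)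
    also have "\<dots> = g a"
      using False by (intro finprod_singleton) auto
    finally show ?thesis .
  qed
  \<comment> \<open>Multiplying by \<open>g i\<close> and \<open>g j\<close> cancels the negative
    exponents; what remains is evaluated by \<open>P\<close>.\<close>
  have "(\<Otimes>l\<in>UNIV - {i1}. g l [^] \<lfloor>x $ l\<rfloor>) \<otimes> (g i \<otimes> g j)
      = (\<Otimes>l\<in>UNIV - {i1}. g l [^] \<lfloor>x $ l\<rfloor> \<otimes> (g l [^] \<delta> i l \<otimes> g l [^] \<delta> j l))"
    by (simp add: finprod_multf Pi_iff P)
  also have "\<dots> = (\<Otimes>l\<in>UNIV - {i1}. g l [^] \<delta> k l \<otimes> g l [^] \<delta> i1 l)"
    unfolding x floor_of_int
    by (intro finprod_cong) (auto simp: simp_implies_def simp flip: int_pow_mult)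
  also have "\<dots> = g k"
    using \<open>g i1 = \<one>\<close> by (simp add: finprod_multf Pi_iff P)
  finally have "(\<Otimes>l\<in>UNIV - {i1}. g l [^] \<lfloor>x $ l\<rfloor>) = \<one>"
    using k by (simp add: Pi_iff)
  with \<open>x \<in> root_lattice_A\<close> show ?thesis
    unfolding group_lattice_def x_def by blast
qed

text \<open>Subtracting the constant \<open>v $ i1\<close> from all coordinates does not change the
  pairing with a zero-sum vector.\<close>

lemma dual_root_latticeI:
  fixes v :: "real ^ 'n"
  assumes "v \<in> zero_sum_space" and "\<And>j. v $ j - v $ i1 \<in> \<int>"
  shows "v \<in> dual_lattice root_lattice_A"
proof -
  have "v \<bullet> x \<in> \<int>" if x: "x \<in> root_lattice_A" for x
  proof -
    have "v \<bullet> x = (\<Sum>j\<in>UNIV. (v $ j - v $ i1) * x $ j) + v $ i1 * (\<Sum>j\<in>UNIV. x $ j)"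
      by (simp add: inner_vec_def sum_distrib_left left_diff_distrib sum_subtractf)
    also have "\<dots> = (\<Sum>j\<in>UNIV. (v $ j - v $ i1) * x $ j)"
      using x by (simp add: root_lattice_A_def)
    also have "\<dots> \<in> \<int>"
      using x assms(2) by (intro Ints_sum Ints_mult) (auto simp: root_lattice_A_def)
    finally show ?thesis .
  qed
  with assms(1) show ?thesis
    by (simp add: dual_lattice_def)
qed

text \<open>Orthogonality of characters: translation by a suitable \<open>g j\<close> permutes the
  summands, yet multiplies the sum by \<open>e(v_j) / e(v_i1)\<close>, which differs from 1.\<close>

lemma sum_cis_eq_0:
  fixes G (structure) and g :: "'n::finite \<Rightarrow> 'a"
  assumes "comm_group G" and bij: "bij_betw g UNIV (carrier G)" and "g i1 = \<one>"
    and v: "v \<in> dual_lattice (group_lattice G g i1)"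
    and not_in: "v \<notin> dual_lattice root_lattice_A"
  shows "(\<Sum>i\<in>UNIV. cis (2 * pi * v $ i)) = 0"
proof -
  interpret comm_group G by fact
  have g: "range g = carrier G" and inj: "inj g"
    using bij by (auto simp: bij_betw_def)
  let ?E = "\<lambda>i. cis (2 * pi * v $ i)"
  obtain j where j: "v $ j - v $ i1 \<notin> \<int>"
    using dual_root_latticeI not_in v unfolding dual_lattice_def by blast
  define \<sigma> where "\<sigma> i = inv_into UNIV g (g i \<otimes> g j)" for i
  have g\<sigma>: "g (\<sigma> i) = g i \<otimes> g j" for i
    unfolding \<sigma>_def using g by (intro f_inv_into_f) auto
  have "inj \<sigma>"
  proof (rule injI)
    fix a b
    assume "\<sigma> a = \<sigma> b"
    then have "g a \<otimes> g j = g b \<otimes> g j"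
      by (metis g\<sigma>)
    then show "a = b"
      using g inj by (metis injD right_cancel rangeI)
  qed
  then have "bij \<sigma>"
    by (simp add: finite_UNIV_inj_surj bij_def)
  have E: "?E i1 * ?E (\<sigma> i) = ?E j * ?E i" for i
  proof -
    let ?r = "axis (\<sigma> i) 1 - axis i 1 - axis j 1 + axis i1 1 :: real ^ 'n"
    have "?r \<in> group_lattice G g i1"
      using assms(1,3) g g\<sigma> by (intro relation_in_group_lattice) auto
    then have "v \<bullet> ?r \<in> \<int>"
      using v by (simp add: dual_lattice_def)
    moreover have "v \<bullet> ?r = v $ \<sigma> i - v $ i - v $ j + v $ i1"
      by (simp add: inner_add_right inner_diff_right inner_axis)
    ultimately have "cis (2 * pi * (v $ \<sigma> i - v $ i - v $ j + v $ i1)) = 1"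
      by simp
    moreover have "2 * pi * v $ i1 + 2 * pi * v $ \<sigma> i = 2 * pi * v $ j + 2 * pi * v $ i
        + 2 * pi * (v $ \<sigma> i - v $ i - v $ j + v $ i1)"
      by (simp add: algebra_simps)
    ultimately show ?thesis
      by (metis cis_mult mult.right_neutral)
  qed
  have "?E i1 * (\<Sum>i\<in>UNIV. ?E i) = ?E i1 * (\<Sum>i\<in>UNIV. ?E (\<sigma> i))"
    using sum.reindex_bij_betw[OF \<open>bij \<sigma>\<close>, of ?E] by simp
  also have "\<dots> = ?E j * (\<Sum>i\<in>UNIV. ?E i)"
    by (simp only: sum_distrib_left E)
  finally have "?E i1 = ?E j \<or> (\<Sum>i\<in>UNIV. ?E i) = 0"
    by (auto simp only: mult_cancel_right)
  moreover have "?E i1 \<noteq> ?E j"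
  proof
    assume "?E i1 = ?E j"
    then have "cis (2 * pi * v $ j - 2 * pi * v $ i1) = 1"
      by (simp flip: cis_divide)
    then obtain m :: int where "2 * pi * v $ j - 2 * pi * v $ i1 = of_int (2 * m) * pi"
      by (auto simp: cis_conv_exp exp_eq_1)
    then have "2 * pi * (v $ j - v $ i1) = 2 * pi * of_int m"
      by (simp add: algebra_simps)
    then have "v $ j - v $ i1 = of_int m"
      by simp
    with j show False
      by simp
  qed
  ultimately show ?thesis
    by blast
qed

lemma short_vector_dual_root_lattice:
  fixes i1 :: "'n::finite"
  assumes "CARD('n) \<ge> 2"
  obtains u :: "real ^ 'n" where "u \<in> dual_lattice root_lattice_A" "u \<noteq> 0"
    "(norm u)\<^sup>2 = (real CARD('n) - 1) / real CARD('n)"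
proof
  define n where "n = real CARD('n)"
  have n: "n \<ge> 2"
    using assms by (simp add: n_def)
  \<comment> \<open>This is the orthogonal projection of a standard basis vector onto the zero-sum
    hyperplane.\<close>
  define u :: "real ^ 'n" where "u = axis i1 1 - (\<chi> i. 1 / n)"
  have u: "u $ i = of_bool (i = i1) - 1 / n" for i
    by (simp add: u_def axis_def)
  have "(\<Sum>i\<in>UNIV. u $ i) = 0"
    using n by (simp add: u sum_subtractf n_def of_bool_def)
  then have "u \<in> zero_sum_space"
    by (simp add: zero_sum_space_def)
  then show "u \<in> dual_lattice root_lattice_A"
    by (rule dual_root_latticeI[where ?i1.0 = i1]) (simp add: u)
  have "(norm u)\<^sup>2 = (\<Sum>i\<in>UNIV. of_bool (i = i1) * (1 - 2 / n) + 1 / n\<^sup>2)"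
    unfolding power2_norm_eq_inner inner_vec_def
    by (intro sum.cong refl) (auto simp: u power2_eq_square algebra_simps)
  also have "\<dots> = (1 - 2 / n) + n * (1 / n\<^sup>2)"
    by (simp add: sum.distrib n_def of_bool_def flip: sum_distrib_right)
  also have "\<dots> = (n - 1) / n"
    using n by (simp add: field_simps power2_eq_square)
  finally show *: "(norm u)\<^sup>2 = (real CARD('n) - 1) / real CARD('n)"
    by (simp add: n_def)
  show "u \<noteq> 0"
    using * n by (auto simp: n_def)
qed

text \<open>A minimal vector of either set is no longer than \<open>u\<close>, so vectors of
  \<open>L\<close> outside \<open>M\<close> are neither minimal nor competitors.\<close>

lemma minimal_vectors_eqI:
  assumes "M \<subseteq> L" and "u \<in> M" "u \<noteq> 0" and "\<And>v. v \<in> L - M \<Longrightarrow> norm u < norm v"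
  shows "minimal_vectors L = minimal_vectors M"
  unfolding minimal_vectors_def using assms
  by (smt (verit) Collect_cong DiffI subsetD)

theorem theorem3p3:
  fixes G :: "('a, 'b) monoid_scheme" (structure)
    and g :: "'n::finite \<Rightarrow> 'a" and i1 :: 'n
  assumes "comm_group G"
    and "finite (carrier G)"
    and "order G \<ge> 15"
    and "bij_betw g UNIV (carrier G)"
    and "g i1 = \<one>"
  shows "minimal_vectors (dual_lattice (group_lattice G g i1)) =
         minimal_vectors (dual_lattice (root_lattice_A :: (real ^ 'n) set))"
proof -
  define n where "n = real CARD('n)"
  have card: "CARD('n) \<ge> 15"
    using assms(3) bij_betw_same_card[OF assms(4)] by (simp add: order_def)
  then have n: "n \<ge> 15"
    by (simp add: n_def)
  obtain u :: "real ^ 'n" where u: "u \<in> dual_lattice root_lattice_A" "u \<noteq> 0"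
    "(norm u)\<^sup>2 = (n - 1) / n"
  proof (rule short_vector_dual_root_lattice)
    show "CARD('n) \<ge> 2"
      using card by simp
  qed (simp add: n_def)
  show ?thesis
  proof (rule minimal_vectors_eqI)
    show "dual_lattice root_lattice_A \<subseteq> dual_lattice (group_lattice G g i1)"
      by (auto simp: dual_lattice_def group_lattice_def)
  next
    fix v
    assume "v \<in> dual_lattice (group_lattice G g i1) - dual_lattice root_lattice_A"
    then have "(\<Sum>i\<in>UNIV. cis (2 * pi * v $ i)) = 0"
      using sum_cis_eq_0 assms by blast
    then have "n / 16 \<le> (norm v)\<^sup>2"
      unfolding n_def by (rule norm_power2_lower_bound)
    moreover have "(n - 1) / n < n / 16"
    proof -
      \<comment> \<open>The product expands to \<open>n^2 - 16 * n + 15\<close>, just below the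
        required \<open>n^2 - 16 * (n - 1)\<close>; this is where \<open>n >= 15\<close>
        enters.\<close>
      have "0 \<le> (n - 15) * (n - 1)"
        using n by simp
      then have "(n - 1) * 16 < n * n"
        by (simp add: algebra_simps)
      then show ?thesis
        using n by (simp add: field_simps)
    qed
    ultimately have "(norm u)\<^sup>2 < (norm v)\<^sup>2"
      using u(3) by linarith
    then show "norm u < norm v"
      by (rule power2_less_imp_less) simp
  qed (use u in auto)
qed

end
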